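(* Let $C\in\mathbb{S}[t]$ be a generic monic quadratic split quaternion polynomial that admits six (pairwise different) factorizations $C=(t-a_\ell)(t-b_\ell)$, $a_\ell,b_\ell\in\mathbb{S}$, $\ell\in\{1,\dots,6\}$. Then the six points $A_\ell=[a_\ell-\overline{a_\ell}]$ are the vertices of a complete quadrilateral whose four sides are null lines, and two vertices $A_\ell,A_m$ of this quadrilateral are opposite if and only if the factorizations $C=(t-a_\ell)(t-b_\ell)$ and $C=(t-a_m)(t-b_m)$ are complementary. Likewise, the six points $B_\ell=[b_\ell-\overline{b_\ell}]$ are the vertices of a complete quadrilateral whose four sides are null lines, and opposite vertices correspond to complementary factorizations.
   Context: Split quaternions: $\mathbb{S}$ is the real associative algebra with basis $1,\mathbf{i},\mathbf{j},\mathbf{k}$ and relations $\mathbf{i}^2=-1$, $\mathbf{j}^2=\mathbf{k}^2=1$, $\mathbf{i}\mathbf{j}\mathbf{k}=1$. The conjugate of $h=h_0+h_1\mathbf{i}+h_2\mathbf{j}+h_3\mathbf{k}$ is $\overline{h}=h_0-h_1\mathbf{i}-h_2\mathbf{j}-h_3\mathbf{k}$, and $h\overline{h}=h_0^2+h_1^2-h_2^2-h_3^2\in\mathbb{R}$. $\mathbb{S}[t]$ is the ring of polynomials over $\mathbb{S}$ in which $t$ commutes with all coefficients. For $C=\sum c_\ell t^\ell$, $\overline{C}=\sum\overline{c_\ell}t^\ell$; then $C\overline{C}\in\mathbb{R}[t]$. Generic: a monic quadratic $C=t^2+c_1t+c_0\in\mathbb{S}[t]$ is generic if (i) $1,c_1,c_0$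 are linearly independent over $\mathbb{R}$, and (ii) for every real monic quadratic factor $M$ of $C\overline{C}$ the linear polynomial $C-M=r_1t+r_0$ has a unique zero, i.e. there is exactly one $h\in\mathbb{S}$ with $r_1h+r_0=0$. Complementary: two factorizations $C=(t-h_1)(t-h_2)=(t-k_1)(t-k_2)$ are complementary if $C\overline{C}=(t-h_1)(t-\overline{h_1})(t-k_1)(t-\overline{k_1})$. Geometry: $V$ is the 3-dimensional real vector space of split quaternions with zero real part, with $\langle a,b\rangle=\tfrac12(a\overline{b}+b\overline{a})$. $P^2$ is the projective plane over $V$, $[a]$ is the point represented by $a\in V\setminus\{0\}$. The line $[u]$, $u\in V\setminus\{0\}$, consists of the points $[x]$ with $\langle u,x\rangle=0$. The null circle is the conic $\{[x]:\langle x,x\rangle=0\}$; its tangents, i.e. the lines $[u]$ with $\langle u,u\rangle=0$, are the null lines. A complete quadrilateral consists of four lines (sides), no three concurrent, and their six pairwise intersection points (vertices); two vertices are opposite if they do not lie on a common side. *)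

theory Defs
  imports "HOL-Analysis.Analysis" "HOL-Library.Poly_Mapping"
begin

section \<open>Split quaternions\<close>

datatype squat = SQuat (q0: real) (q1: real) (q2: real) (q3: real)

lemma squat_eq_iff: "x = y \<longleftrightarrow> q0 x = q0 y \<and> q1 x = q1 y \<and> q2 x = q2 y \<and> q3 x = q3 y"
  by (cases x; cases y) auto

instantiation squat :: real_algebra_1
begin

definition "0 = SQuat 0 0 0 0"
definition "1 = SQuat 1 0 0 0"
definition "x + y = SQuat (q0 x + q0 y) (q1 x + q1 y) (q2 x + q2 y) (q3 x + q3 y)"
definition "- x = SQuat (- q0 x) (- q1 x) (- q2 x) (- q3 x)"
definition "x - y = SQuat (q0 x - q0 y) (q1 x - q1 y) (q2 x - q2 y) (q3 x - q3 y)"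
definition "r *\<^sub>R x = SQuat (r * q0 x) (r * q1 x) (r * q2 x) (r * q3 x)"

text \<open>The product is determined by the defining relations; see the lemmas
  \<open>squat_relations\<close> and \<open>squat_basis\<close> below.\<close>

definition "x * y = SQuat
  (q0 x * q0 y - q1 x * q1 y + q2 x * q2 y + q3 x * q3 y)
  (q0 x * q1 y + q1 x * q0 y - q2 x * q3 y + q3 x * q2 y)
  (q0 x * q2 y + q2 x * q0 y - q1 x * q3 y + q3 x * q1 y)
  (q0 x * q3 y + q3 x * q0 y + q1 x * q2 y - q2 x * q1 y)"

lemmas squat_defs = zero_squat_def one_squat_def plus_squat_def uminus_squat_def
  minus_squat_def scaleR_squat_def times_squat_def

instance
  by standard (auto simp: squat_defs squat_eq_iff algebra_simps)

end

definition qi :: squat where "qi = SQuat 0 1 0 0"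
definition qj :: squat where "qj = SQuat 0 0 1 0"
definition qk :: squat where "qk = SQuat 0 0 0 1"

lemma squat_relations:
  "qi * qi = -1" "qj * qj = 1" "qk * qk = 1" "qi * qj * qk = 1"
  by (simp_all add: qi_def qj_def qk_def squat_defs)

lemma squat_basis:
  "h = of_real (q0 h) + q1 h *\<^sub>R qi + q2 h *\<^sub>R qj + q3 h *\<^sub>R qk"
  by (simp add: of_real_def qi_def qj_def qk_def squat_defs)

definition qcnj :: "squat \<Rightarrow> squat" where
  "qcnj h = SQuat (q0 h) (- q1 h) (- q2 h) (- q3 h)"

lemma mult_qcnj: "h * qcnj h = of_real ((q0 h)\<^sup>2 + (q1 h)\<^sup>2 - (q2 h)\<^sup>2 - (q3 h)\<^sup>2)"
  by (simp add: qcnj_def of_real_def squat_defs power2_eq_square)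


section \<open>Polynomials over the split quaternions\<close>

text \<open>The library type \<open>'a poly\<close> has a product only over commutative coefficients.
  Finitely supported functions on the exponents with the convolution product give the polynomial
  ring over an arbitrary ring, with the indeterminate commuting with all coefficients.\<close>

type_synonym 'a upoly = "nat \<Rightarrow>\<^sub>0 'a"

definition const :: "'a::zero \<Rightarrow> 'a upoly" where
  "const c = Poly_Mapping.single 0 c"

definition tvar :: "'a::zero_neq_one upoly" where
  "tvar = Poly_Mapping.single 1 1"

definition monic_quadratic :: "'a::ring_1 upoly \<Rightarrow> bool" where
  "monic_quadratic C \<longleftrightarrow> (\<exists>c1 c0. C = tvar ^ 2 + const c1 * tvar + const c0)"

text \<open>Coefficientwise application of a map that sends 0 to 0.\<close>

definition pcnj :: "squat upoly \<Rightarrow> squat upoly" where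
  "pcnj C = Poly_Mapping.map qcnj C"

definition real_upoly :: "real upoly \<Rightarrow> squat upoly" where
  "real_upoly M = Poly_Mapping.map of_real M"

definition real_factor :: "real upoly \<Rightarrow> squat upoly \<Rightarrow> bool" where
  "real_factor M P \<longleftrightarrow> (\<exists>N. P = real_upoly M * real_upoly N)"

definition generic :: "squat upoly \<Rightarrow> bool" where
  "generic C \<longleftrightarrow>
     monic_quadratic C \<and>
     distinct [1, Poly_Mapping.lookup C 1, Poly_Mapping.lookup C 0] \<and>
     independent {1, Poly_Mapping.lookup C 1, Poly_Mapping.lookup C 0} \<and>
     (\<forall>M. monic_quadratic M \<and> real_factor M (C * pcnj C) \<longrightarrow>
        (\<exists>!h. Poly_Mapping.lookup (C - real_upoly M) 1 * h
              + Poly_Mapping.lookup (C - real_upoly M) 0 = 0))"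

definition factorization :: "squat upoly \<Rightarrow> squat \<Rightarrow> squat \<Rightarrow> bool" where
  "factorization C h1 h2 \<longleftrightarrow> C = (tvar - const h1) * (tvar - const h2)"

definition complementary ::
    "squat upoly \<Rightarrow> squat \<times> squat \<Rightarrow> squat \<times> squat \<Rightarrow> bool" where
  "complementary C = (\<lambda>(h1, h2) (k1, k2).
     factorization C h1 h2 \<and> factorization C k1 k2 \<and>
     C * pcnj C = (tvar - const h1) * (tvar - const (qcnj h1))
                * (tvar - const k1) * (tvar - const (qcnj k1)))"


section \<open>The projective plane over the vector split quaternions\<close>

definition vecq :: "squat set" where
  "vecq = {h. q0 h = 0}"

definition qform :: "squat \<Rightarrow> squat \<Rightarrow> real" where
  "qform a b = q0 ((1/2) *\<^sub>R (a * qcnj b + b * qcnj a))"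

lemma of_real_qform: "of_real (qform a b) = (1/2) *\<^sub>R (a * qcnj b + b * qcnj a)"
  by (simp add: qform_def qcnj_def of_real_def squat_defs)

text \<open>A point is a one-dimensional subspace of \<open>vecq\<close>, a line is the set of points on it.
  Note that \<open>pt 0\<close> is not a point and lies on no line.\<close>

definition pt :: "squat \<Rightarrow> squat set" where
  "pt a = span {a}"

definition pline :: "squat \<Rightarrow> squat set set" where
  "pline u = {pt x | x. x \<in> vecq \<and> x \<noteq> 0 \<and> qform u x = 0}"

definition is_line :: "squat set set \<Rightarrow> bool" where
  "is_line L \<longleftrightarrow> (\<exists>u\<in>vecq. u \<noteq> 0 \<and> L = pline u)"

definition null_line :: "squat set set \<Rightarrow> bool" where
  "null_line L \<longleftrightarrow> (\<exists>u\<in>vecq. u \<noteq> 0 \<and> qform u u = 0 \<and> L = pline u)"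

text \<open>A complete quadrilateral is given by its set \<open>Q\<close> of sides.\<close>

definition complete_quadrilateral :: "squat set set set \<Rightarrow> bool" where
  "complete_quadrilateral Q \<longleftrightarrow>
     card Q = 4 \<and> (\<forall>L\<in>Q. is_line L) \<and>
     (\<forall>K\<in>Q. \<forall>L\<in>Q. \<forall>M\<in>Q. K \<noteq> L \<and> K \<noteq> M \<and> L \<noteq> M \<longrightarrow> K \<inter> L \<inter> M = {})"

definition vertices :: "squat set set set \<Rightarrow> squat set set" where
  "vertices Q = {P. \<exists>K\<in>Q. \<exists>L\<in>Q. K \<noteq> L \<and> P \<in> K \<inter> L}"

definition opposite :: "squat set set set \<Rightarrow> squat set \<Rightarrow> squat set \<Rightarrow> bool" where
  "opposite Q P R \<longleftrightarrow> P \<in> vertices Q \<and> R \<in> vertices Q \<and> \<not> (\<exists>L\<in>Q. P \<in> L \<and> R \<in> L)"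

end

theory Submission
  imports Defs "HOL-Computational_Algebra.Fundamental_Theorem_Algebra"
begin

text \<open>The norm polynomials of the left factors \<open>t - a\<^sub>l\<close> are real quadratic divisors of the quartic
  \<open>C * pcnj C\<close>, and by genericity they determine the factorizations. A real quartic with
  six monic quadratic divisors has four different real roots \<open>r\<^sub>i\<close>, so the factorizations correspond to the
  two-element sets of roots, complementary ones to disjoint sets. The values \<open>C(r\<^sub>i)\<close> are nonzero
  and singular; in terms of 2 by 2 matrices, the image of \<open>C(r\<^sub>i)\<close> is a point of the real
  projective line, and the corresponding null vector \<open>u\<^sub>i = C(r\<^sub>i) * qi * qcnj (C(r\<^sub>i))\<close> satisfies
  \<open>u\<^sub>i * a\<^sub>l = r\<^sub>i u\<^sub>i\<close> whenever \<open>r\<^sub>i\<close> is a root of the norm polynomial of \<open>t - a\<^sub>l\<close>. Hence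
  \<open>A\<^sub>l\<close> lies on exactly the two null lines \<open>[u\<^sub>i]\<close> belonging to its two roots. The statement on the
  right factors follows by conjugation.\<close>

section \<open>Quadratic divisors of a quartic\<close>

text \<open>Induction on \<open>I\<close>: if \<open>z j\<close> is a root of \<open>q\<close>, the
  factor at \<open>z j\<close> cancels from \<open>q\<close>, otherwise from the cofactor. Working
  with index sets instead of sets of roots allows repeated values of \<open>z\<close>.\<close>

lemma monic_dvd_prod_linear:
  fixes z :: "'i \<Rightarrow> 'a::field"
  assumes "finite I" "lead_coeff q = 1" "q dvd (\<Prod>i\<in>I. [:- z i, 1:])"
  shows "\<exists>T\<subseteq>I. q = (\<Prod>i\<in>T. [:- z i, 1:])"
  using assms
proof (induction I arbitrary: q rule: finite_induct)
  case empty
  then have "q dvd 1" by simp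
  then obtain c where "q = [:c:]" by (rule is_unit_polyE)
  with empty(1) have "q = 1" by simp
  then show ?case by auto
next
  case (insert j I)
  obtain r where "(\<Prod>i\<in>insert j I. [:- z i, 1:]) = q * r"
    using insert(5) by (rule dvdE)
  then have r: "[:- z j, 1:] * (\<Prod>i\<in>I. [:- z i, 1:]) = q * r"
    by (simp only: prod.insert[OF insert(1,2)])
  show ?case
  proof (cases "poly q (z j) = 0")
    case True
    then obtain q' where q': "q = [:- z j, 1:] * q'"
      by (metis poly_eq_0_iff_dvd dvdE)
    have "[:- z j, 1:] * (\<Prod>i\<in>I. [:- z i, 1:]) = [:- z j, 1:] * (q' * r)"
      using r unfolding q' by (metis mult.assoc)
    then have "(\<Prod>i\<in>I. [:- z i, 1:]) = q' * r"
      by (subst (asm) mult_left_cancel) auto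
    moreover have "lead_coeff q' = 1"
      using insert(4) unfolding q' lead_coeff_mult by simp
    ultimately obtain T where "T \<subseteq> I" "q' = (\<Prod>i\<in>T. [:- z i, 1:])"
      using insert(3) by (metis dvd_triv_left)
    then have "q = (\<Prod>i\<in>insert j T. [:- z i, 1:])"
      using insert(1,2) q' by (subst prod.insert) (auto intro: finite_subset)
    with \<open>T \<subseteq> I\<close> show ?thesis by blast
  next
    case False
    have "poly ([:- z j, 1:] * (\<Prod>i\<in>I. [:- z i, 1:])) (z j) = 0"
      by simp
    with False have "poly r (z j) = 0"
      unfolding r by simp
    then obtain r' where r': "r = [:- z j, 1:] * r'"
      by (metis poly_eq_0_iff_dvd dvdE)
    have "[:- z j, 1:] * (\<Prod>i\<in>I. [:- z i, 1:]) = [:- z j, 1:] * (q * r')"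
      using r unfolding r' by (metis mult.left_commute)
    then have "(\<Prod>i\<in>I. [:- z i, 1:]) = q * r'"
      by (subst (asm) mult_left_cancel) auto
    then show ?thesis
      using insert(3)[OF insert(4)] by (metis dvd_triv_left subset_insertI2)
  qed
qed

lemma degree_prod_linear:
  fixes z :: "'i \<Rightarrow> 'a::field"
  shows "degree (\<Prod>i\<in>T. [:- z i, 1:]) = card T"
  by (subst degree_prod_eq_sum_degree) auto

lemma poly_prod_linear_eq_0_iff:
  fixes r :: "'i \<Rightarrow> 'a::field"
  assumes "finite S"
  shows "poly (\<Prod>i\<in>S. [:- r i, 1:]) x = 0 \<longleftrightarrow> x \<in> r ` S"
  using assms by (auto simp: poly_prod prod_zero_iff)

lemma prod_linear_eq_iff:
  fixes r :: "'i \<Rightarrow> 'a::field"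
  assumes "finite I" "inj_on r I" "S \<subseteq> I" "T \<subseteq> I"
  shows "(\<Prod>i\<in>S. [:- r i, 1:]) = (\<Prod>i\<in>T. [:- r i, 1:]) \<longleftrightarrow> S = T"
proof
  have fin: "finite S" "finite T"
    using assms finite_subset by blast+
  assume "(\<Prod>i\<in>S. [:- r i, 1:]) = (\<Prod>i\<in>T. [:- r i, 1:])"
  then have "x \<in> r ` S \<longleftrightarrow> x \<in> r ` T" for x
    using poly_prod_linear_eq_0_iff[OF fin(1), of r x] poly_prod_linear_eq_0_iff[OF fin(2), of r x]
    by simp
  then have "r ` S = r ` T" by blast
  then show "S = T"
    using assms by (simp add: inj_on_image_eq_iff)
qed simp

lemma monic_quartic_complex_roots:
  fixes P :: "complex poly"
  assumes "degree P = 4" "lead_coeff P = 1"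
  obtains z where "P = (\<Prod>i<4::nat. [:- z i, 1:])"
proof -
  obtain A where A: "size A = 4" "P = (\<Prod>x\<in>#A. [:- x, 1:])"
    using alg_closed_imp_factorization[of P] assms by fastforce
  obtain xs where xs: "mset xs = A"
    using ex_mset by blast
  have "(\<Prod>x\<in>#A. [:- x, 1:]) = prod_list (map (\<lambda>x. [:- x, 1:]) xs)"
    unfolding xs[symmetric] by (metis mset_map prod_mset_prod_list)
  also have "\<dots> = (\<Prod>i<4. [:- (xs ! i), 1:])"
    using A(1) xs by (auto simp: prod.list_conv_set_nth lessThan_atLeast0)
  finally show ?thesis using that[of "\<lambda>i. xs ! i"] A(2) by simp
qed

text \<open>Over the complex numbers each \<open>M l\<close> is the product of the linear factors
  over a two-element set of root indices. There are exactly six such sets, so the six different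
  divisors use all of them, and this forces the roots to be distinct and real.\<close>

lemma six_quadratic_divisors:
  fixes M M' :: "'l \<Rightarrow> real poly"
  assumes L: "card L = 6" and inj: "inj_on M L"
    and deg: "\<And>l. l \<in> L \<Longrightarrow> degree (M l) = 2" "\<And>l. l \<in> L \<Longrightarrow> lead_coeff (M l) = 1"
      "\<And>l. l \<in> L \<Longrightarrow> lead_coeff (M' l) = 1"
    and P: "\<And>l. l \<in> L \<Longrightarrow> M l * M' l = P" and "degree P = 4"
  obtains r :: "nat \<Rightarrow> real" and T where "inj_on r {..<4}"
    "bij_betw T L {S. S \<subseteq> {..<4} \<and> card S = 2}"
    "\<And>l. l \<in> L \<Longrightarrow> M l = (\<Prod>i\<in>T l. [:- r i, 1:])"
    "\<And>l. l \<in> L \<Longrightarrow> M' l = (\<Prod>i\<in>{..<4} - T l. [:- r i, 1:])"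
proof -
  let ?c = "map_poly complex_of_real"
  have c_inj: "p = q" if "?c p = ?c q" for p q
    using that by (simp add: poly_eq_iff coeff_map_poly)
  have c_mult: "?c (p * q) = ?c p * ?c q" for p q
    by (simp add: poly_eq_iff coeff_map_poly coeff_mult)
  have c_prod: "?c (prod p S) = (\<Prod>i\<in>S. ?c (p i))" if "finite S" for p and S :: "nat set"
    using that by (induction) (auto simp: c_mult)
  have L0: "finite L" "L \<noteq> {}"
    using L by (auto intro: card_ge_0_finite)
  then obtain l0 where l0: "l0 \<in> L" by blast
  have "lead_coeff P = 1"
    using P[OF l0] deg[OF l0] by (metis lead_coeff_mult mult_1)
  then have "lead_coeff (?c P) = 1"
    by (simp add: coeff_map_poly degree_map_poly)
  moreover have "degree (?c P) = 4"
    using \<open>degree P = 4\<close> by (simp add: degree_map_poly)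
  ultimately obtain z where z: "?c P = (\<Prod>i<4::nat. [:- z i, 1:])"
    using monic_quartic_complex_roots by blast
  have "\<exists>T\<subseteq>{..<4}. ?c (M l) = (\<Prod>i\<in>T. [:- z i, 1:])" if "l \<in> L" for l
  proof (rule monic_dvd_prod_linear)
    show "lead_coeff (?c (M l)) = 1"
      using deg that by (simp add: coeff_map_poly degree_map_poly)
    show "?c (M l) dvd (\<Prod>i<4. [:- z i, 1:])"
      unfolding z[symmetric] P[OF that, symmetric] c_mult by simp
  qed simp
  then obtain T where T: "\<And>l. l \<in> L \<Longrightarrow> T l \<subseteq> {..<4}"
    "\<And>l. l \<in> L \<Longrightarrow> ?c (M l) = (\<Prod>i\<in>T l. [:- z i, 1:])"
    by metis
  let ?S = "{S::nat set. S \<subseteq> {..<4} \<and> card S = 2}"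
  have cT: "card (T l) = 2" if "l \<in> L" for l
  proof -
    have "degree (?c (M l)) = 2"
      using deg(1)[OF that] by (simp add: degree_map_poly)
    then show ?thesis
      unfolding T(2)[OF that] degree_prod_linear .
  qed
  have injT: "inj_on T L"
    by (rule inj_onI) (metis T(2) c_inj inj inj_onD)
  have "card ?S = 4 choose 2"
    using n_subsets[of "{..<4::nat}" 2] by simp
  also have "\<dots> = 6" by (simp add: choose_two)
  finally have cS: "card ?S = 6" .
  \<comment> \<open>An injective map from six indices into a set of six elements is onto.\<close>
  have "T ` L = ?S"
  proof (rule card_subset_eq)
    show "finite ?S" by (rule finite_subset[of _ "Pow {..<4}"]) auto
  qed (use cS T(1) cT L card_image[OF injT] in auto)
  with injT have bij: "bij_betw T L ?S"
    by (simp add: bij_betw_def)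
  have pair: "\<exists>l\<in>L. T l = {i, j}" if "i \<noteq> j" "i < 4" "j < 4" for i j
  proof -
    have "{i, j} \<in> ?S" using that by auto
    then show ?thesis using \<open>T ` L = ?S\<close> by (metis (no_types, lifting) imageE)
  qed
  \<comment> \<open>Every product of two linear factors is one of the six divisors, so these products are
    pairwise different and real.\<close>
  have Zinj: "inj_on z {..<4}"
  proof (rule inj_onI, rule ccontr)
    fix i j assume ij: "i \<in> {..<4::nat}" "j \<in> {..<4}" "z i = z j" "i \<noteq> j"
    \<comment> \<open>If \<open>z i = z j\<close>, the pairs \<open>{i, k}\<close> and
      \<open>{j, k}\<close> give the same quadratic although they belong to different indices in
      \<open>L\<close>.\<close>
    obtain k where k: "k \<noteq> i" "k \<noteq> j" "k < (4::nat)"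
    proof -
      have "\<not> {..<4::nat} \<subseteq> {i, j}"
        using card_mono[of "{i,j}" "{..<4}"] ij(4) by auto
      then show ?thesis using that by auto
    qed
    obtain l m where lm: "l \<in> L" "T l = {i, k}" "m \<in> L" "T m = {j, k}"
      using pair[of i k] pair[of j k] k ij by auto
    then have "?c (M l) = ?c (M m)"
      using T(2) k ij by simp
    then have "l = m"
      using c_inj inj lm by (meson inj_onD)
    then show False using lm ij k by (auto simp: doubleton_eq_iff)
  qed
  have sum_real: "Im (z i) + Im (z j) = 0" if ij: "i \<noteq> j" "i < 4" "j < 4" for i j
  proof -
    obtain l where l: "l \<in> L" "T l = {i, j}"
      using pair[OF ij] by blast
    have "coeff (?c (M l)) 1 = coeff ([:- z i, 1:] * [:- z j, 1:]) 1"
      using T(2)[OF l(1)] l(2) ij by simp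
    then have "complex_of_real (coeff (M l) 1) = - z i - z j"
      by (simp add: coeff_map_poly)
    then have "Im (- z i - z j) = 0"
      by (metis Im_complex_of_real)
    then show ?thesis by simp
  qed
  \<comment> \<open>With two further indices \<open>j\<close> and \<open>k\<close>, the three
    pairwise sums of imaginary parts vanish, hence so does each summand.\<close>
  have "Im (z i) = 0" if "i < 4" for i
  proof -
    obtain j k :: nat where "j < 4" "k < 4" "j \<noteq> i" "k \<noteq> i" "j \<noteq> k"
    proof (cases "i < 2")
      case True
      then show ?thesis using that[of 2 3] by simp
    next
      case False
      then show ?thesis using that[of 0 1] by simp
    qed
    then show ?thesis using sum_real[of i j] sum_real[of i k] sum_real[of j k] that by linarith
  qed
  then have zr: "z i = complex_of_real (Re (z i))" if "i < 4" for i
    using that by (simp add: complex_eq_iff)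
  define r where "r = (\<lambda>i. Re (z i))"
  have injr: "inj_on r {..<4}"
    using Zinj zr unfolding r_def inj_on_def by (metis lessThan_iff)
  have fac: "?c (\<Prod>i\<in>S. [:- r i, 1:]) = (\<Prod>i\<in>S. [:- z i, 1:])" if "S \<subseteq> {..<4}" for S
  proof -
    have "?c (\<Prod>i\<in>S. [:- r i, 1:]) = (\<Prod>i\<in>S. ?c [:- r i, 1:])"
      using that by (intro c_prod) (auto intro: finite_subset)
    also have "\<dots> = (\<Prod>i\<in>S. [:- z i, 1:])"
      using that zr by (intro prod.cong) (auto simp: r_def map_poly_pCons)
    finally show ?thesis .
  qed
  have M: "M l = (\<Prod>i\<in>T l. [:- r i, 1:])" if "l \<in> L" for l
    using T[OF that] fac c_inj by metis
  have Pr: "P = (\<Prod>i<4. [:- r i, 1:])"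
    using z fac[of "{..<4}"] c_inj by simp
  have "M' l = (\<Prod>i\<in>{..<4} - T l. [:- r i, 1:])" if "l \<in> L" for l
  proof -
    have "M l * M' l = M l * (\<Prod>i\<in>{..<4} - T l. [:- r i, 1:])"
      using P[OF that] Pr M[OF that] prod.subset_diff[OF T(1)[OF that], of "\<lambda>i. [:- r i, 1:]"]
      by (simp add: mult.commute)
    moreover have "M l \<noteq> 0" using deg(1)[OF that] by auto
    ultimately show ?thesis by simp
  qed
  with injr bij M show thesis by (rule that)
qed

section \<open>Factorizations and norm polynomials\<close>

definition quad :: "'a::ring_1 \<Rightarrow> 'a \<Rightarrow> 'a upoly" where
  "quad c1 c0 = tvar ^ 2 + const c1 * tvar + const c0"

lemma quad_single:
  "quad c1 c0 = Poly_Mapping.single 2 1 + Poly_Mapping.single 1 c1 + Poly_Mapping.single 0 c0"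
  by (simp add: quad_def tvar_def const_def mult_single power2_eq_square numeral_2_eq_2)

lemma lookup_quad:
  "Poly_Mapping.lookup (quad c1 c0) n = (if n = 0 then c0 else if n = 1 then c1 else if n = 2 then 1 else 0)"
  by (simp add: quad_single lookup_add lookup_single when_def)

lemma quad_eq_iff: "quad p q = quad r s \<longleftrightarrow> p = r \<and> q = s"
proof
  assume "quad p q = quad r s"
  then have "Poly_Mapping.lookup (quad p q) n = Poly_Mapping.lookup (quad r s) n" for n
    by simp
  from this[of 0] this[of 1] show "p = r \<and> q = s"
    by (simp add: lookup_quad)
qed simp

lemma linear_mult_linear: "(tvar - const a) * (tvar - const b) = quad (- a - b) (a * b)"
  unfolding quad_single tvar_def const_def
  by (simp add: algebra_simps mult_single single_diff single_uminus flip: numeral_2_eq_2)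

lemma map_quad:
  assumes "f 0 = 0" "f 1 = 1"
  shows "Poly_Mapping.map f (quad p q) = quad (f p) (f q)"
  using assms by (intro poly_mapping_eqI) (auto simp: Poly_Mapping.map.rep_eq lookup_quad when_def)

text \<open>Comparison of the coefficients of degree 0 to 3 moves an identity over the split
  quaternions to real polynomials, where factors can be cancelled.\<close>

lemma quad_mult_quad_eqD:
  fixes p q r s :: real
  assumes "quad (of_real p) (of_real q) * quad (of_real r) (of_real s)
    = (quad (of_real p') (of_real q') * quad (of_real r') (of_real s') :: squat upoly)"
  shows "[:q, p, 1:] * [:s, r, 1:] = [:q', p', 1:] * [:s', r', 1:]"
proof -
  have lk: "Poly_Mapping.lookup (quad p q * quad r s) 3 = p + r"
    "Poly_Mapping.lookup (quad p q * quad r s) 2 = q + s + p * r"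
    "Poly_Mapping.lookup (quad p q * quad r s) 1 = p * s + q * r"
    "Poly_Mapping.lookup (quad p q * quad r s) 0 = q * s" for p q r s :: squat
    unfolding quad_single
    by (simp_all add: algebra_simps mult_single lookup_add lookup_single when_def)
  have "p + r = p' + r'" "q + s + p * r = q' + s' + p' * r'"
     "p * s + q * r = p' * s' + q' * r'" "q * s = q' * s'"
    using arg_cong[OF assms, where f = "\<lambda>f. Poly_Mapping.lookup f 3", unfolded lk]
     arg_cong[OF assms, where f = "\<lambda>f. Poly_Mapping.lookup f 2", unfolded lk]
     arg_cong[OF assms, where f = "\<lambda>f. Poly_Mapping.lookup f 1", unfolded lk]
     arg_cong[OF assms, where f = "\<lambda>f. Poly_Mapping.lookup f 0", unfolded lk]
    by (simp_all flip: of_real_add of_real_mult)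
  then show ?thesis by (simp add: algebra_simps)
qed

section \<open>Conjugation, norm and characteristic polynomial of a split quaternion\<close>

lemma qcnj_simps [simp]:
  "qcnj (x + y) = qcnj x + qcnj y" "qcnj (x - y) = qcnj x - qcnj y" "qcnj (- x) = - qcnj x"
  "qcnj (x * y) = qcnj y * qcnj x" "qcnj (qcnj x) = x" "qcnj (of_real t) = of_real t"
  "qcnj 0 = 0" "qcnj 1 = 1" "qcnj (t *\<^sub>R x) = t *\<^sub>R qcnj x" "qcnj qi = - qi"
  by (simp_all add: qcnj_def squat_defs squat_eq_iff of_real_def qi_def algebra_simps)

definition qnorm :: "squat \<Rightarrow> real" where
  "qnorm h = (q0 h)\<^sup>2 + (q1 h)\<^sup>2 - (q2 h)\<^sup>2 - (q3 h)\<^sup>2"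

lemma mult_qcnj_qnorm: "h * qcnj h = of_real (qnorm h)" "qcnj h * h = of_real (qnorm h)"
  using mult_qcnj[of h] mult_qcnj[of "qcnj h"] by (simp_all add: qnorm_def qcnj_def)

lemma add_qcnj: "h + qcnj h = of_real (2 * q0 h)"
  by (simp add: qcnj_def squat_defs squat_eq_iff of_real_def)

text \<open>The norm polynomial of \<open>t - h\<close>, which is the characteristic polynomial of
  \<open>h\<close> as a 2 by 2 matrix (trace \<open>2 * q0 h\<close>, determinant
  \<open>qnorm h\<close>). It lives in \<open>poly\<close> so that degrees, roots and divisibility
  are at hand.\<close>

definition charpoly :: "squat \<Rightarrow> real poly" where
  "charpoly h = [:qnorm h, - 2 * q0 h, 1:]"

lemma charpoly_qcnj [simp]: "charpoly (qcnj h) = charpoly h"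
  by (simp add: charpoly_def qnorm_def qcnj_def)

lemma charpoly_monic: "degree (charpoly h) = 2" "lead_coeff (charpoly h) = 1" "charpoly h \<noteq> 0"
  by (simp_all add: charpoly_def)

lemma poly_charpoly: "(of_real x - h) * (of_real x - qcnj h) = of_real (poly (charpoly h) x)"
  "(of_real x - qcnj h) * (of_real x - h) = of_real (poly (charpoly h) x)"
  by (simp_all add: charpoly_def qcnj_def squat_defs squat_eq_iff of_real_def qnorm_def
      algebra_simps power2_eq_square)

text \<open>The same polynomial as \<open>charpoly h\<close>, as an element of the noncommutative
  ring that contains \<open>C\<close>.\<close>

definition nquad :: "squat \<Rightarrow> squat upoly" where
  "nquad h = quad (of_real (- 2 * q0 h)) (of_real (qnorm h))"

lemma linear_mult_cnj_linear:
  "(tvar - const h) * (tvar - const (qcnj h)) = nquad h"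
  "(tvar - const (qcnj h)) * (tvar - const h) = nquad h"
proof -
  have "- h - qcnj h = of_real (- 2 * q0 h)"
    by (simp add: qcnj_def squat_defs squat_eq_iff of_real_def)
  moreover have "- qcnj h - h = of_real (- 2 * q0 h)"
    by (simp add: qcnj_def squat_defs squat_eq_iff of_real_def)
  ultimately show "(tvar - const h) * (tvar - const (qcnj h)) = nquad h"
    "(tvar - const (qcnj h)) * (tvar - const h) = nquad h"
    unfolding linear_mult_linear nquad_def by (simp_all only: mult_qcnj_qnorm)
qed

lemma nquad_mult_eqD:
  assumes "nquad g * nquad h = nquad g' * nquad h'"
  shows "charpoly g * charpoly h = charpoly g' * charpoly h'"
  unfolding charpoly_def by (rule quad_mult_quad_eqD) (use assms in \<open>simp add: nquad_def\<close>)

lemma nquad_cong: "charpoly g = charpoly h \<Longrightarrow> nquad g = nquad h"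
  by (simp add: charpoly_def nquad_def)

text \<open>The coefficients are real, hence central; it suffices to check monomials.\<close>

lemma nquad_commute:
  "nquad h * (tvar - const c) = (tvar - const c) * nquad h"
  "nquad h * nquad g = nquad g * nquad h"
proof -
  have *: "nquad h * Poly_Mapping.single n c = Poly_Mapping.single n c * nquad h" for n c
    unfolding nquad_def quad_single
    by (simp add: distrib_left distrib_right mult_single add.commute of_real_def)
  show "nquad h * (tvar - const c) = (tvar - const c) * nquad h"
    by (simp add: tvar_def const_def * left_diff_distrib right_diff_distrib)
  show "nquad h * nquad g = nquad g * nquad h"
    unfolding nquad_def[of g] quad_single by (simp only: * distrib_left distrib_right)
qed

section \<open>Factorizations, complementarity and genericity in terms of norm polynomials\<close>

lemma factorization_iff:
  "factorization (quad c1 c0) a b \<longleftrightarrow> c1 = - a - b \<and> c0 = a * b"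
  by (simp add: factorization_def linear_mult_linear quad_eq_iff)

text \<open>In \<open>(t - a) (t - b) (t - qcnj b) (t - qcnj a)\<close> the two middle factors form
  the central polynomial \<open>nquad b\<close>, which can be moved to the end.\<close>

lemma factorization_norm:
  assumes "factorization C a b"
  shows "C * pcnj C = nquad a * nquad b"
proof -
  have C: "C = (tvar - const a) * (tvar - const b)"
    using assms by (simp add: factorization_def)
  have "pcnj C = (tvar - const (qcnj b)) * (tvar - const (qcnj a))"
    unfolding C linear_mult_linear pcnj_def by (subst map_quad) (simp_all add: minus_diff_commute)
  then have "C * pcnj C = (tvar - const a) * (nquad b * (tvar - const (qcnj a)))"
    unfolding C linear_mult_cnj_linear(1)[symmetric] by (simp only: mult.assoc)
  also have "\<dots> = (tvar - const a) * (tvar - const (qcnj a)) * nquad b"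
    by (simp only: nquad_commute(1) mult.assoc)
  finally show ?thesis by (simp only: linear_mult_cnj_linear)
qed

text \<open>Both sides of the defining equation contain the factor \<open>nquad a\<close>; it is
  cancelled after passing to real polynomials.\<close>

lemma complementary_iff:
  assumes "factorization C a b" "factorization C a' b'"
  shows "complementary C (a, b) (a', b') \<longleftrightarrow> charpoly a' = charpoly b"
proof -
  have "complementary C (a, b) (a', b') \<longleftrightarrow> nquad a * nquad b = nquad a * nquad a'"
    using assms factorization_norm[OF assms(1)] linear_mult_cnj_linear(1)
    by (simp add: complementary_def mult.assoc)
  also have "\<dots> \<longleftrightarrow> charpoly a' = charpoly b"
    using nquad_mult_eqD[of a b a a'] nquad_cong[of a' b] charpoly_monic(3)[of a] by auto
  finally show ?thesis .
qed

text \<open>Let \<open>M\<close> be the common norm polynomial of the right factors. Then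
  \<open>b\<close> and \<open>b'\<close> are both zeros of the linear polynomial
  \<open>C - M\<close>, which has only one zero by genericity.\<close>

lemma generic_charpoly_inj:
  assumes gen: "generic C" and f: "factorization C a b" "factorization C a' b'"
    and eq: "charpoly b = charpoly b'"
  shows "a = a' \<and> b = b'"
proof -
  obtain c1 c0 where C: "C = quad c1 c0"
    using gen by (auto simp: generic_def monic_quadratic_def quad_def)
  define M where "M = quad (- 2 * q0 b) (qnorm b)"
  have rM: "real_upoly M = nquad b"
    unfolding real_upoly_def M_def nquad_def by (subst map_quad) auto
  have "real_upoly (quad (- 2 * q0 a) (qnorm a)) = nquad a"
    unfolding real_upoly_def nquad_def by (subst map_quad) auto
  then have "C * pcnj C = real_upoly M * real_upoly (quad (- 2 * q0 a) (qnorm a))"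
    unfolding factorization_norm[OF f(1)] rM by (simp only: nquad_commute(2))
  then have "real_factor M (C * pcnj C)"
    by (auto simp: real_factor_def)
  moreover have "monic_quadratic M"
    by (auto simp: monic_quadratic_def M_def quad_def)
  ultimately have "\<exists>!h. Poly_Mapping.lookup (C - real_upoly M) 1 * h
              + Poly_Mapping.lookup (C - real_upoly M) 0 = 0"
    using gen by (auto simp: generic_def)
  moreover have "Poly_Mapping.lookup (C - real_upoly M) 1 * h
              + Poly_Mapping.lookup (C - real_upoly M) 0 = 0"
    if "factorization C g h" "charpoly h = charpoly b" for g h
  proof -
    have "real_upoly M = nquad h"
      unfolding rM by (rule nquad_cong[OF that(2)[symmetric]])
    \<comment> \<open>Since \<open>M = (t - qcnj h) (t - h)\<close> and
      \<open>C = (t - g) (t - h)\<close>, the difference \<open>C - M\<close> equals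
      \<open>(qcnj h - g) (t - h)\<close> and vanishes at \<open>h\<close>.\<close>
    also have "nquad h = quad (- qcnj h - h) (qcnj h * h)"
      using linear_mult_cnj_linear(2) linear_mult_linear by metis
    finally show ?thesis
      using that(1) unfolding C factorization_iff by (simp add: lookup_minus lookup_quad algebra_simps)
  qed
  ultimately have "b = b'"
    using f eq by metis
  then show ?thesis
    using f unfolding C factorization_iff by (metis diff_add_cancel neg_equal_iff_equal)
qed

text \<open>A real zero of \<open>C\<close> would express \<open>c0\<close> as a real combination of
  \<open>1\<close> and \<open>c1\<close>, against their independence.\<close>

lemma generic_eval_nonzero:
  assumes "generic (quad c1 c0)"
  shows "of_real (x\<^sup>2) + x *\<^sub>R c1 + c0 \<noteq> 0"
proof
  assume "of_real (x\<^sup>2) + x *\<^sub>R c1 + c0 = 0"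
  then have "c0 = - (of_real (x\<^sup>2) + x *\<^sub>R c1)"
    by (simp add: add_eq_0_iff)
  then have "c0 = (- x\<^sup>2) *\<^sub>R 1 + (- x) *\<^sub>R c1"
    by (simp add: of_real_def)
  then have "c0 \<in> span {1, c1}"
    by (metis insertI1 insertI2 span_add span_base span_scale)
  moreover have "{1, c1, c0} - {c0} = {1, c1}" "independent {1, c1, c0}"
    using assms by (auto simp: generic_def lookup_quad)
  ultimately show False
    unfolding dependent_def by auto
qed

section \<open>Null lines\<close>

lemma qform_vecq:
  "u \<in> vecq \<Longrightarrow> x \<in> vecq \<Longrightarrow> qform u x = q1 u * q1 x - q2 u * q2 x - q3 u * q3 x"
  by (simp add: qform_def vecq_def qcnj_def squat_defs)

lemma qform_scale_right: "qform u (r *\<^sub>R x) = r * qform u x"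
  by (simp add: qform_def qcnj_def squat_defs algebra_simps)

lemma pt_eq_iff:
  assumes "x \<noteq> 0" "y \<noteq> 0"
  shows "pt x = pt y \<longleftrightarrow> (\<exists>r. y = r *\<^sub>R x)"
proof
  assume "pt x = pt y"
  then have "y \<in> span {x}"
    unfolding pt_def by (metis insertI1 span_base)
  then show "\<exists>r. y = r *\<^sub>R x"
    by (auto simp: span_singleton)
next
  assume "\<exists>r. y = r *\<^sub>R x"
  then obtain r where r: "y = r *\<^sub>R x" by blast
  then have r': "x = inverse r *\<^sub>R y" using assms by auto
  have "y \<in> span {x}"
    unfolding r by (simp add: span_base span_scale)
  moreover have "x \<in> span {y}"
    by (subst r') (simp add: span_base span_scale)
  ultimately show "pt x = pt y"
    by (simp add: pt_def span_eq)
qed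

lemma pt_uminus: "pt (- x) = pt x"
  using pt_eq_iff[of x "- x"] by (cases "x = 0") (auto intro: exI[of _ "-1"])

lemma pt_in_pline:
  assumes "x \<in> vecq" "x \<noteq> 0"
  shows "pt x \<in> pline u \<longleftrightarrow> qform u x = 0"
proof
  assume "pt x \<in> pline u"
  then obtain y where y: "pt x = pt y" "y \<noteq> 0" "qform u y = 0"
    by (auto simp: pline_def)
  then obtain r where "x = r *\<^sub>R y"
    using pt_eq_iff[of y x] assms by auto
  with y show "qform u x = 0" by (simp add: qform_scale_right)
qed (use assms in \<open>auto simp: pline_def\<close>)

section \<open>Null vectors as points of the unit circle, and their tangents\<close>

definition null_vec :: "squat \<Rightarrow> bool" where
  "null_vec u \<longleftrightarrow> u \<in> vecq \<and> u \<noteq> 0 \<and> qform u u = 0"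

text \<open>A nonzero null vector satisfies \<open>q1\<^sup>2 = q2\<^sup>2 + q3\<^sup>2\<close> with
  \<open>q1\<close> nonzero. Scaling to \<open>q1 = 1\<close> identifies the null circle with the
  unit circle.\<close>

lemma null_vec_normalize:
  assumes "null_vec u"
  obtains r p q where "r \<noteq> 0" "u = r *\<^sub>R SQuat 0 1 p q" "p\<^sup>2 + q\<^sup>2 = 1"
proof -
  have u: "q0 u = 0" "(q1 u)\<^sup>2 = (q2 u)\<^sup>2 + (q3 u)\<^sup>2" "u \<noteq> 0"
    using assms qform_vecq[of u u] by (auto simp: null_vec_def vecq_def power2_eq_square)
  have r: "q1 u \<noteq> 0"
    using u by (auto simp: squat_eq_iff zero_squat_def sum_power2_eq_zero_iff)
  show ?thesis
  proof (rule that[OF r])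
    show "u = q1 u *\<^sub>R SQuat 0 1 (q2 u / q1 u) (q3 u / q1 u)"
      using u r by (simp add: squat_eq_iff scaleR_squat_def)
    show "(q2 u / q1 u)\<^sup>2 + (q3 u / q1 u)\<^sup>2 = 1"
      using r unfolding power_divide add_divide_distrib[symmetric] u(2)[symmetric] by simp
  qed
qed

lemma qform_normalized:
  "qform (r *\<^sub>R SQuat 0 1 p q) x = r * (q1 x - p * q2 x - q * q3 x)" if "x \<in> vecq"
  using that by (simp add: qform_def vecq_def qcnj_def squat_defs algebra_simps)

lemma qform_normalized2:
  "qform (a *\<^sub>R SQuat 0 1 p q) (b *\<^sub>R SQuat 0 1 r s) = a * b * (1 - p * r - q * s)"
  by (simp add: qform_def qcnj_def squat_defs algebra_simps)

lemma qform_parallel: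
  "p\<^sup>2 + q\<^sup>2 = 1 \<Longrightarrow> qform (a *\<^sub>R SQuat 0 1 p q) (b *\<^sub>R SQuat 0 1 p q) = 0"
  by (simp add: qform_normalized2 power2_eq_square)

text \<open>In unit circle coordinates orthogonality says that two unit vectors have inner product
  1, so they are equal.\<close>

lemma null_vec_orthogonal:
  assumes "null_vec u" "null_vec w" "qform u w = 0"
  shows "\<exists>r. w = r *\<^sub>R u"
proof -
  obtain a p q where u: "a \<noteq> 0" "u = a *\<^sub>R SQuat 0 1 p q" "p\<^sup>2 + q\<^sup>2 = 1"
    using assms null_vec_normalize by blast
  obtain b r s where w: "b \<noteq> 0" "w = b *\<^sub>R SQuat 0 1 r s" "r\<^sup>2 + s\<^sup>2 = 1"
    using assms null_vec_normalize by blast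
  have "1 = p * r + q * s"
    using assms(3) u w by (simp add: qform_normalized2)
  then have "(p - r)\<^sup>2 + (q - s)\<^sup>2 = 0"
    using u(3) w(3) by (simp add: power2_diff)
  then have "p = r" "q = s"
    by (simp_all add: sum_power2_eq_zero_iff)
  then have "w = (b / a) *\<^sub>R u"
    using u w by simp
  then show ?thesis ..
qed

lemma null_lines_meet:
  assumes "null_vec u" "null_vec w" "qform u w \<noteq> 0"
    and x: "x \<in> vecq" "x \<noteq> 0" "qform u x = 0" "qform w x = 0"
    and y: "y \<in> vecq" "y \<noteq> 0" "qform u y = 0" "qform w y = 0"
  shows "pt x = pt y"
proof -
  obtain a p q where u: "a \<noteq> 0" "u = a *\<^sub>R SQuat 0 1 p q" "p\<^sup>2 + q\<^sup>2 = 1"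
    using assms null_vec_normalize by blast
  obtain b r s where w: "b \<noteq> 0" "w = b *\<^sub>R SQuat 0 1 r s" "r\<^sup>2 + s\<^sup>2 = 1"
    using assms null_vec_normalize by blast
  \<comment> \<open>\<open>g\<close> spans the common solutions of the two linear equations
    \<open>q1 = p q2 + q q3\<close> and \<open>q1 = r q2 + s q3\<close>.\<close>
  define g where "g = SQuat 0 (p * (s - q) + q * (p - r)) (s - q) (p - r)"
  have ne: "p \<noteq> r \<or> q \<noteq> s"
    using assms(3) u w by (auto simp: qform_parallel)
  have *: "\<exists>k. v = k *\<^sub>R g" if v: "v \<in> vecq" "qform u v = 0" "qform w v = 0" for v
  proof -
    have e: "q0 v = 0" "q1 v = p * q2 v + q * q3 v" "q1 v = r * q2 v + s * q3 v"
      using v u w by (auto simp: qform_normalized vecq_def)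
    then have e': "(p - r) * q2 v = (s - q) * q3 v"
      by (simp add: algebra_simps)
    show ?thesis
    proof (cases "p = r")
      case True
      with ne e' have "q3 v = 0" by simp
      with e True ne show ?thesis
        by (intro exI[of _ "q2 v / (s - q)"]) (auto simp: g_def squat_eq_iff scaleR_squat_def field_simps)
    next
      case False
      then have "q2 v = (s - q) * q3 v / (p - r)"
        using e' by (simp add: field_simps)
      with e False show ?thesis
        by (intro exI[of _ "q3 v / (p - r)"]) (auto simp: g_def squat_eq_iff scaleR_squat_def field_simps)
    qed
  qed
  obtain k where k: "x = k *\<^sub>R g" using * x by blast
  obtain m where m: "y = m *\<^sub>R g" using * y by blast
  have "y = (m / k) *\<^sub>R x"
    using k m x by auto
  with x y show ?thesis using pt_eq_iff by blast
qed

text \<open>No three tangents of a conic are concurrent. For a common point, the vector of its last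
  two coordinates would be orthogonal to the chords between the three points of contact and also
  parallel to one of them.\<close>

lemma null_lines_not_concurrent:
  assumes "null_vec u" "null_vec w" "null_vec v" "qform u w \<noteq> 0" "qform u v \<noteq> 0" "qform w v \<noteq> 0"
    and x: "x \<in> vecq" "qform u x = 0" "qform w x = 0" "qform v x = 0"
  shows "x = 0"
proof (rule ccontr)
  assume "x \<noteq> 0"
  obtain a p q where u: "a \<noteq> 0" "u = a *\<^sub>R SQuat 0 1 p q" "p\<^sup>2 + q\<^sup>2 = 1"
    using assms null_vec_normalize by blast
  obtain b r s where w: "b \<noteq> 0" "w = b *\<^sub>R SQuat 0 1 r s" "r\<^sup>2 + s\<^sup>2 = 1"
    using assms null_vec_normalize by blast
  obtain c e f where v: "c \<noteq> 0" "v = c *\<^sub>R SQuat 0 1 e f" "e\<^sup>2 + f\<^sup>2 = 1"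
    using assms null_vec_normalize by blast
  have ne: "p \<noteq> r \<or> q \<noteq> s" "p \<noteq> e \<or> q \<noteq> f" "r \<noteq> e \<or> s \<noteq> f"
    using assms(4,5,6) u w v
    by (auto simp: qform_parallel)
  have l: "q0 x = 0" "q1 x = p * q2 x + q * q3 x" "q1 x = r * q2 x + s * q3 x"
    "q1 x = e * q2 x + f * q3 x"
    using x u w v by (auto simp: qform_normalized vecq_def)
  have x23: "(q2 x)\<^sup>2 + (q3 x)\<^sup>2 \<noteq> 0"
    using \<open>x \<noteq> 0\<close> l by (auto simp: squat_eq_iff zero_squat_def sum_power2_eq_zero_iff)
  \<comment> \<open>The chord of two points of the unit circle is orthogonal to the sum of the points.\<close>
  have chord: "q2 x * (q + s) = q3 x * (p + r)" if
    "p\<^sup>2 + q\<^sup>2 = 1" "r\<^sup>2 + s\<^sup>2 = 1" "p \<noteq> r \<or> q \<noteq> s"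
    "p * q2 x + q * q3 x = r * q2 x + s * q3 x" for p q r s
  proof -
    have 1: "(p - r) * q2 x + (q - s) * q3 x = 0" using that by (simp add: algebra_simps)
    have 2: "(p - r) * (p + r) + (q - s) * (q + s) = 0"
      using that by (simp add: algebra_simps power2_eq_square)
    have "(p - r) * (q2 x * (q + s) - q3 x * (p + r)) = 0"
      "(q - s) * (q2 x * (q + s) - q3 x * (p + r)) = 0"
      using 1 2 by algebra+
    with that(3) show ?thesis by auto
  qed
  have "q2 x * (q + s) = q3 x * (p + r)" "q2 x * (q + f) = q3 x * (p + e)"
    using chord[of p q r s] chord[of p q e f] u w v ne l by auto
  \<comment> \<open>Subtracting the relations for the two chords at \<open>(p, q)\<close> shows that
    \<open>(q2 x, q3 x)\<close> is parallel to the third chord; the next line says that it is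
    orthogonal to it.\<close>
  then have 1: "q2 x * (s - f) = q3 x * (r - e)" by (simp add: algebra_simps)
  have 2: "q2 x * (r - e) + q3 x * (s - f) = 0" using l by (simp add: algebra_simps)
  have "((q2 x)\<^sup>2 + (q3 x)\<^sup>2) * (r - e) = 0" "((q2 x)\<^sup>2 + (q3 x)\<^sup>2) * (s - f) = 0"
    using 1 2 by algebra+
  with x23 ne show False by auto
qed

text \<open>The incidence part of the theorem: once each point is known to lie on exactly the two
  sides indexed by \<open>T l\<close>, the rest is the combinatorics of two-element subsets of a
  four-element set.\<close>

lemma null_quadrilateral:
  fixes u :: "'i \<Rightarrow> squat" and v :: "'l \<Rightarrow> squat"
  assumes I: "card I = 4" and u: "\<And>i. i \<in> I \<Longrightarrow> null_vec (u i)"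
    and indep: "\<And>i j. i \<in> I \<Longrightarrow> j \<in> I \<Longrightarrow> i \<noteq> j \<Longrightarrow> qform (u i) (u j) \<noteq> 0"
    and T: "bij_betw T L {S. S \<subseteq> I \<and> card S = 2}"
    and v: "\<And>l. l \<in> L \<Longrightarrow> v l \<in> vecq" "\<And>l. l \<in> L \<Longrightarrow> v l \<noteq> 0"
    and uv: "\<And>l i. l \<in> L \<Longrightarrow> i \<in> T l \<Longrightarrow> qform (u i) (v l) = 0"
  shows "\<exists>Q. complete_quadrilateral Q \<and> (\<forall>L\<in>Q. null_line L) \<and>
    bij_betw (\<lambda>l. pt (v l)) L (vertices Q) \<and>
    (\<forall>l\<in>L. \<forall>m\<in>L. opposite Q (pt (v l)) (pt (v m)) \<longleftrightarrow> T l \<inter> T m = {})"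
proof -
  have TL: "T l \<subseteq> I" "card (T l) = 2" if "l \<in> L" for l
    using T that by (auto simp: bij_betw_def)
  have Tinj: "inj_on T L" and Tim: "T ` L = {S. S \<subseteq> I \<and> card S = 2}"
    using T by (auto simp: bij_betw_def)
  have conc: "i = j \<or> i = k \<or> j = k"
    if "i \<in> I" "j \<in> I" "k \<in> I" "x \<in> vecq" "x \<noteq> 0"
      "qform (u i) x = 0" "qform (u j) x = 0" "qform (u k) x = 0" for i j k x
    using null_lines_not_concurrent[of "u i" "u j" "u k" x] u indep that by blast
  \<comment> \<open>A third side through this point would make three null lines concurrent.\<close>
  have inc: "pt (v l) \<in> pline (u i) \<longleftrightarrow> i \<in> T l" if l: "l \<in> L" and i: "i \<in> I" for l i
  proof -
    obtain j k where jk: "T l = {j, k}" "j \<noteq> k"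
      using TL(2)[OF l] by (auto simp: card_2_iff)
    have "i \<in> T l" if "qform (u i) (v l) = 0"
      using conc[of i j k "v l"] jk TL[OF l] that i v[OF l] uv[OF l] by auto
    then show ?thesis
      using pt_in_pline[OF v[OF l]] uv[OF l] by blast
  qed
  have uI: "u i \<in> vecq" "u i \<noteq> 0" "qform (u i) (u i) = 0" if "i \<in> I" for i
    using u[OF that] by (auto simp: null_vec_def)
  \<comment> \<open>The point of contact of \<open>u i\<close> lies on its own null line but, by
    \<open>indep\<close>, on none of the others.\<close>
  have inj: "inj_on (\<lambda>i. pline (u i)) I"
    by (rule inj_onI) (metis indep pt_in_pline uI)
  define Q where "Q = (\<lambda>i. pline (u i)) ` I"
  have nulls: "\<forall>L\<in>Q. null_line L"
    using uI by (auto simp: Q_def null_line_def)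
  have "complete_quadrilateral Q"
    unfolding complete_quadrilateral_def
  proof (intro conjI ballI impI)
    show "card Q = 4" unfolding Q_def using card_image[OF inj] I by simp
    show "is_line L" if "L \<in> Q" for L
      using nulls that by (auto simp: null_line_def is_line_def)
    fix K L M assume KLM: "K \<in> Q" "L \<in> Q" "M \<in> Q" "K \<noteq> L \<and> K \<noteq> M \<and> L \<noteq> M"
    then obtain i j k where ijk: "i \<in> I" "j \<in> I" "k \<in> I" "K = pline (u i)" "L = pline (u j)"
      "M = pline (u k)" by (auto simp: Q_def)
    show "K \<inter> L \<inter> M = {}"
    proof (rule ccontr)
      assume "K \<inter> L \<inter> M \<noteq> {}"
      then obtain P where P: "P \<in> K" "P \<in> L" "P \<in> M" by blast
      then obtain x where x: "P = pt x" "x \<in> vecq" "x \<noteq> 0"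
        unfolding ijk by (auto simp: pline_def)
      have "qform (u i) x = 0" "qform (u j) x = 0" "qform (u k) x = 0"
        using P pt_in_pline[OF x(2,3)] unfolding ijk x(1) by blast+
      then have "i = j \<or> i = k \<or> j = k"
        using conc ijk(1-3) x(2,3) by blast
      then show False
        using KLM(4) ijk(4-6) by blast
    qed
  qed
  moreover have vert: "vertices Q = (\<lambda>l. pt (v l)) ` L"
  proof (intro equalityI subsetI)
    fix P assume "P \<in> vertices Q"
    then obtain i j where ij: "i \<in> I" "j \<in> I" "i \<noteq> j" "P \<in> pline (u i)" "P \<in> pline (u j)"
      by (auto simp: vertices_def Q_def)
    then obtain x where x: "P = pt x" "x \<in> vecq" "x \<noteq> 0"
      by (auto simp: pline_def)
    have "{i, j} \<in> T ` L" unfolding Tim using ij by auto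
    then obtain l where l: "l \<in> L" "T l = {i, j}" by auto
    have "pt x = pt (v l)"
      by (rule null_lines_meet[of "u i" "u j"])
        (use ij x l u indep v uv pt_in_pline in auto)
    with x l show "P \<in> (\<lambda>l. pt (v l)) ` L" by blast
  next
    fix P assume "P \<in> (\<lambda>l. pt (v l)) ` L"
    then obtain l where l: "l \<in> L" "P = pt (v l)" by blast
    obtain j k where jk: "T l = {j, k}" "j \<noteq> k"
      using TL(2)[OF l(1)] by (auto simp: card_2_iff)
    then have "j \<in> I" "k \<in> I" using TL l by auto
    moreover have "pline (u j) \<noteq> pline (u k)"
      using inj jk calculation by (auto simp: inj_on_def)
    moreover have "P \<in> pline (u j) \<inter> pline (u k)"
      using inc[of l] l jk calculation by auto
    ultimately show "P \<in> vertices Q"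
      unfolding vertices_def Q_def by blast
  qed
  moreover have "inj_on (\<lambda>l. pt (v l)) L"
  proof (rule inj_onI)
    fix l m assume lm: "l \<in> L" "m \<in> L" "pt (v l) = pt (v m)"
    then have "i \<in> T l \<longleftrightarrow> i \<in> T m" if "i \<in> I" for i
      using inc that by metis
    then have "T l = T m" using TL lm by blast
    then show "l = m" using Tinj lm by (auto dest: inj_onD)
  qed
  moreover have "opposite Q (pt (v l)) (pt (v m)) \<longleftrightarrow> T l \<inter> T m = {}" if "l \<in> L" "m \<in> L" for l m
  proof -
    have "opposite Q (pt (v l)) (pt (v m)) \<longleftrightarrow> \<not> (\<exists>i\<in>I. i \<in> T l \<and> i \<in> T m)"
      unfolding opposite_def vert using that inc by (auto simp: Q_def)
    then show ?thesis using TL that by blast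
  qed
  ultimately show ?thesis using nulls
    by (intro exI[of _ Q]) (auto simp: bij_betw_def)
qed

section \<open>Null vectors from singular split quaternions\<close>

text \<open>The square of \<open>c * qi * qcnj c\<close> contains the factor
  \<open>qcnj c * c = 0\<close>. The choice of \<open>qi\<close> makes the \<open>q1\<close>
  component a sum of four squares, so the vector is not zero.\<close>

lemma sandwich_null_vec:
  assumes "qnorm c = 0" "c \<noteq> 0"
  shows "null_vec (c * qi * qcnj c)"
proof -
  let ?u = "c * qi * qcnj c"
  have "qcnj ?u = - ?u" by (simp add: mult.assoc)
  then have "?u \<in> vecq" by (simp add: vecq_def qcnj_def squat_eq_iff uminus_squat_def)
  moreover have "q1 ?u = (q0 c)\<^sup>2 + (q1 c)\<^sup>2 + (q2 c)\<^sup>2 + (q3 c)\<^sup>2"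
    by (simp add: squat_defs qi_def qcnj_def power2_eq_square algebra_simps)
  then have "?u \<noteq> 0"
    using assms(2) by (auto simp: squat_eq_iff zero_squat_def add_nonneg_eq_0_iff)
  moreover have "?u * ?u = c * qi * (qcnj c * c) * qi * qcnj c" by (simp only: mult.assoc)
  then have "?u * ?u = 0" using assms(1) by (simp add: mult_qcnj_qnorm)
  then have "qform ?u ?u = 0"
    unfolding qform_def \<open>qcnj ?u = - ?u\<close> by (simp, simp add: zero_squat_def)
  ultimately show ?thesis by (simp add: null_vec_def)
qed

text \<open>\<open>qcnj c\<close> ends in \<open>of_real x - qcnj a\<close>, so right multiplication
  by \<open>of_real x - a\<close> produces the value of \<open>charpoly a\<close> at its root
  \<open>x\<close>.\<close>

lemma sandwich_eigen:
  assumes "poly (charpoly a) x = 0" "c = (of_real x - a) * d"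
  shows "c * qi * qcnj c * a = x *\<^sub>R (c * qi * qcnj c)"
proof -
  have "c * qi * qcnj c * (of_real x - a)
    = c * qi * qcnj d * ((of_real x - qcnj a) * (of_real x - a))"
    using assms(2) by (simp add: mult.assoc)
  also have "\<dots> = 0" using assms(1) by (simp add: poly_charpoly)
  finally show ?thesis by (simp add: right_diff_distrib) (simp add: of_real_def)
qed

text \<open>Conjugating the hypothesis gives \<open>qcnj a * u = x *\<^sub>R u\<close>. As
  \<open>a + qcnj a\<close> is central, the anticommutator of \<open>u\<close> and
  \<open>a - qcnj a\<close> is \<open>2 * (u * a - qcnj a * u) = 0\<close>, and on vectors
  \<open>qform\<close> is \<open>-1/2\<close> times the anticommutator.\<close>

lemma eigen_orthogonal:
  assumes u: "u \<in> vecq" and e: "u * a = x *\<^sub>R u"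
  shows "qform u (a - qcnj a) = 0"
proof -
  have cu: "qcnj u = - u" using u by (simp add: vecq_def qcnj_def squat_eq_iff uminus_squat_def)
  have e': "qcnj a * u = x *\<^sub>R u"
    using arg_cong[OF e, of qcnj] by (simp add: cu)
  have "u * (a + qcnj a) = (a + qcnj a) * u"
    unfolding add_qcnj by (simp add: of_real_def)
  then have "a * u - u * qcnj a = u * a - qcnj a * u"
    by (simp add: algebra_simps)
  then have "u * (a - qcnj a) + (a - qcnj a) * u = 2 * (u * a - qcnj a * u)"
    unfolding right_diff_distrib left_diff_distrib mult_2 by (simp add: algebra_simps)
  also have "\<dots> = 0" using e e' by simp
  finally show ?thesis
    by (simp add: qform_def cu algebra_simps) (simp add: zero_squat_def)
qed

section \<open>The quadrilateral of a polynomial\<close>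

lemma pt_conj: "pt (qcnj b - b) = pt (b - qcnj b)"
  using pt_uminus[of "b - qcnj b"] by simp

lemma vecq_minus_qcnj: "a - qcnj a \<in> vecq"
  by (simp add: vecq_def qcnj_def squat_defs)

text \<open>Here \<open>c i\<close> stands for the value of the polynomial at \<open>r i\<close>,
  the same for all its factorizations. Stated for arbitrary factors, it serves for \<open>C\<close>
  and for its conjugate.\<close>

lemma factor_quadrilateral:
  fixes a b :: "'l \<Rightarrow> squat" and c :: "nat \<Rightarrow> squat"
  assumes r: "inj_on r {..<4::nat}"
    and T: "bij_betw T L {S. S \<subseteq> {..<4} \<and> card S = 2}"
    and ch: "\<And>l. l \<in> L \<Longrightarrow> charpoly (a l) = (\<Prod>i\<in>T l. [:- r i, 1:])"
    and c: "\<And>i l. l \<in> L \<Longrightarrow> c i = (of_real (r i) - a l) * (of_real (r i) - b l)"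
    and c0: "\<And>i. c i \<noteq> 0"
  shows "\<exists>Q. complete_quadrilateral Q \<and> (\<forall>L\<in>Q. null_line L) \<and>
    bij_betw (\<lambda>l. pt (a l - qcnj (a l))) L (vertices Q) \<and>
    (\<forall>l\<in>L. \<forall>m\<in>L. opposite Q (pt (a l - qcnj (a l))) (pt (a m - qcnj (a m)))
       \<longleftrightarrow> T l \<inter> T m = {})"
proof -
  define u where "u i = c i * qi * qcnj (c i)" for i
  have TL: "T l \<subseteq> {..<4}" "card (T l) = 2" if "l \<in> L" for l
    using T that by (auto simp: bij_betw_def)
  have pair: "\<exists>l\<in>L. T l = {i, j}" if "i \<noteq> j" "i < 4" "j < 4" for i j
  proof -
    have "{i, j} \<in> T ` L" using T that by (auto simp: bij_betw_def)
    then show ?thesis by (metis imageE)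
  qed
  have root: "poly (charpoly (a l)) (r i) = 0" if "l \<in> L" "i \<in> T l" for l i
    using that TL(1)[OF that(1)] finite_subset[OF TL(1)[OF that(1)]]
    by (simp add: ch poly_prod_linear_eq_0_iff)
  have eigen: "u i * a l = r i *\<^sub>R u i" if "l \<in> L" "i \<in> T l" for l i
    unfolding u_def by (rule sandwich_eigen[OF root[OF that] c[OF that(1)]])
  \<comment> \<open>Some \<open>T l\<close> contains \<open>i\<close>; then
    \<open>of_real (r i) - a l\<close> is a left factor of \<open>c i\<close> of norm zero.\<close>
  have null: "null_vec (u i)" if "i < 4" for i
  proof -
    obtain j :: nat where j: "j \<noteq> i" "j < 4"
      using that[of 0] by (cases "i = 0") (auto intro: that[of 1])
    obtain l where l: "l \<in> L" "i \<in> T l"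
      using pair[of i j] j \<open>i < 4\<close> by auto
    have "qcnj (c i) * c i = qcnj (of_real (r i) - b l) *
        ((of_real (r i) - qcnj (a l)) * (of_real (r i) - a l)) * (of_real (r i) - b l)"
      unfolding c[OF l(1)] by (simp add: mult.assoc)
    also have "\<dots> = 0"
      using root[OF l] by (simp add: poly_charpoly)
    finally have "qnorm (c i) = 0"
      by (simp add: mult_qcnj_qnorm)
    then show ?thesis unfolding u_def using c0 by (rule sandwich_null_vec)
  qed
  have uv: "qform (u i) (a l - qcnj (a l)) = 0" if "l \<in> L" "i \<in> T l" for l i
    using null[of i] TL(1)[OF that(1)] that eigen_orthogonal[OF _ eigen[OF that]]
    by (auto simp: null_vec_def)
  \<comment> \<open>If \<open>a l\<close> were real, its norm polynomial would be a square and could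
    not have two different roots.\<close>
  have v0: "a l - qcnj (a l) \<noteq> 0" if l: "l \<in> L" for l
  proof
    assume "a l - qcnj (a l) = 0"
    then have "q1 (a l) = 0" "q2 (a l) = 0" "q3 (a l) = 0"
      by (simp_all add: qcnj_def squat_defs)
    then have *: "poly (charpoly (a l)) x = (x - q0 (a l))\<^sup>2" for x
      by (simp add: charpoly_def qnorm_def power2_eq_square algebra_simps)
    obtain j k where jk: "T l = {j, k}" "j \<noteq> k"
      using TL(2)[OF l] by (auto simp: card_2_iff)
    then have "r j = r k"
      using root[OF l, of j] root[OF l, of k] by (simp add: *)
    then show False using r jk TL(1)[OF l] by (auto simp: inj_on_def)
  qed
  \<comment> \<open>Otherwise \<open>u i\<close> and \<open>u j\<close> are proportional, and right
    multiplication by the \<open>a l\<close> with \<open>T l = {i, j}\<close> would have the two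
    eigenvalues \<open>r i\<close> and \<open>r j\<close> on the same vector.\<close>
  have indep: "qform (u i) (u j) \<noteq> 0" if ij: "i < 4" "j < 4" "i \<noteq> j" for i j
  proof
    assume "qform (u i) (u j) = 0"
    then obtain s where s: "u j = s *\<^sub>R u i"
      using null_vec_orthogonal null ij by blast
    obtain l where l: "l \<in> L" "T l = {i, j}" using pair[OF ij(3,1,2)] by blast
    have "r j *\<^sub>R u j = s *\<^sub>R (u i * a l)"
      using eigen[OF l(1), of j] l(2) s by simp
    also have "\<dots> = r i *\<^sub>R u j"
      using eigen[OF l(1), of i] l(2) s by simp
    finally have "r i = r j"
      using null[OF \<open>j < 4\<close>] by (simp add: null_vec_def)
    then show False using r ij by (auto simp: inj_on_def)
  qed
  show ?thesis
    by (rule null_quadrilateral[where I = "{..<4}" and u = u])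
      (use null indep T vecq_minus_qcnj v0 uv in auto)
qed

section \<open>Two-element subsets of a four-element set\<close>

lemma bij_betw_complement_pairs:
  assumes I: "finite I" "card I = 4" and T: "bij_betw T L {S. S \<subseteq> I \<and> card S = 2}"
  shows "bij_betw (\<lambda>l. I - T l) L {S. S \<subseteq> I \<and> card S = 2}"
proof -
  have "bij_betw (\<lambda>S. I - S) {S. S \<subseteq> I \<and> card S = 2} {S. S \<subseteq> I \<and> card S = 2}"
    by (rule bij_betwI[where g = "\<lambda>S. I - S"])
      (use I in \<open>auto simp: card_Diff_subset finite_subset\<close>)
  from bij_betw_trans[OF T this] show ?thesis by (simp add: comp_def)
qed

text \<open>A subset of the complement with the same size is the complement. This turns the equation
  of norm polynomials for complementary factorizations into disjointness of root sets.\<close>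

lemma disjoint_complement_pairs:
  assumes I: "finite I" "card I = 4" and S: "S \<subseteq> I" "card S = 2" and T: "T \<subseteq> I" "card T = 2"
  shows "S \<inter> T = {} \<longleftrightarrow> T = I - S"
proof
  assume "S \<inter> T = {}"
  moreover have "card (I - S) = 2"
    using I S by (simp add: card_Diff_subset finite_subset)
  ultimately show "T = I - S"
    using I T by (intro card_subset_eq) auto
qed auto

theorem corollary1:
  fixes C :: "squat upoly" and a b :: "nat \<Rightarrow> squat"
  assumes "monic_quadratic C" and "generic C"
    and "\<And>l. l \<in> {1..6} \<Longrightarrow> factorization C (a l) (b l)"
    and "inj_on (\<lambda>l. (a l, b l)) {1..6}"
  shows
    "(\<exists>Q. complete_quadrilateral Q \<and> (\<forall>L\<in>Q. null_line L) \<and>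
        bij_betw (\<lambda>l. pt (a l - qcnj (a l))) {1..6} (vertices Q) \<and>
        (\<forall>l\<in>{1..6}. \<forall>m\<in>{1..6}. l \<noteq> m \<longrightarrow>
           (opposite Q (pt (a l - qcnj (a l))) (pt (a m - qcnj (a m)))
            \<longleftrightarrow> complementary C (a l, b l) (a m, b m)))) \<and>
     (\<exists>Q. complete_quadrilateral Q \<and> (\<forall>L\<in>Q. null_line L) \<and>
        bij_betw (\<lambda>l. pt (b l - qcnj (b l))) {1..6} (vertices Q) \<and>
        (\<forall>l\<in>{1..6}. \<forall>m\<in>{1..6}. l \<noteq> m \<longrightarrow>
           (opposite Q (pt (b l - qcnj (b l))) (pt (b m - qcnj (b m)))
            \<longleftrightarrow> complementary C (a l, b l) (a m, b m))))"
proof -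
  let ?L = "{1..6::nat}"
  note fac = assms(3)
  obtain c1 c0 where C: "C = quad c1 c0"
    using assms(1) by (auto simp: monic_quadratic_def quad_def)
  define P where "P = charpoly (a 1) * charpoly (b 1)"
  have P: "charpoly (a l) * charpoly (b l) = P" if "l \<in> ?L" for l
    unfolding P_def
    by (rule nquad_mult_eqD) (use factorization_norm[OF fac] that in \<open>metis atLeastAtMost_iff le_refl one_le_numeral\<close>)
  \<comment> \<open>Equal norm polynomials on the left give, by cancellation in \<open>P\<close>,
    equal ones on the right, where genericity applies.\<close>
  have injA: "inj_on (\<lambda>l. charpoly (a l)) ?L"
  proof (rule inj_onI)
    fix l m assume lm: "l \<in> ?L" "m \<in> ?L" "charpoly (a l) = charpoly (a m)"
    then have "charpoly (a l) * charpoly (b l) = charpoly (a l) * charpoly (b m)"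
      using P by metis
    then have "charpoly (b l) = charpoly (b m)"
      using charpoly_monic(3) by simp
    then have "(a l, b l) = (a m, b m)"
      using generic_charpoly_inj[OF assms(2) fac[OF lm(1)] fac[OF lm(2)]] by simp
    then show "l = m" using assms(4) lm by (auto dest: inj_onD)
  qed
  have "degree P = 4"
    unfolding P_def by (simp add: degree_mult_eq charpoly_monic)
  then obtain r T where r: "inj_on r {..<4::nat}"
    and T: "bij_betw T ?L {S. S \<subseteq> {..<4} \<and> card S = 2}"
    and A: "\<And>l. l \<in> ?L \<Longrightarrow> charpoly (a l) = (\<Prod>i\<in>T l. [:- r i, 1:])"
    and B: "\<And>l. l \<in> ?L \<Longrightarrow> charpoly (b l) = (\<Prod>i\<in>{..<4} - T l. [:- r i, 1:])"
    using six_quadratic_divisors[of ?L "\<lambda>l. charpoly (a l)" "\<lambda>l. charpoly (b l)" P]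
      injA P charpoly_monic by auto
  have TL: "T l \<subseteq> {..<4}" "card (T l) = 2" if "l \<in> ?L" for l
    using T that by (auto simp: bij_betw_def)
  have compl: "complementary C (a l, b l) (a m, b m) \<longleftrightarrow> T l \<inter> T m = {}"
    if lm: "l \<in> ?L" "m \<in> ?L" for l m
  proof -
    have "charpoly (a m) = charpoly (b l) \<longleftrightarrow> T m = {..<4} - T l"
      unfolding A[OF lm(2)] B[OF lm(1)]
      by (rule prod_linear_eq_iff[OF _ r]) (use TL lm in auto)
    also have "\<dots> \<longleftrightarrow> T l \<inter> T m = {}"
      using disjoint_complement_pairs[of "{..<4}" "T l" "T m"] TL lm by simp
    finally show ?thesis
      using complementary_iff[OF fac[OF lm(1)] fac[OF lm(2)]] by simp
  qed
  \<comment> \<open>The value of \<open>C\<close> at the real number \<open>r i\<close>, which is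
    central, so every factorization of \<open>C\<close> can be evaluated there.\<close>
  define c where "c i = of_real ((r i)\<^sup>2) + r i *\<^sub>R c1 + c0" for i
  have c0: "c i \<noteq> 0" for i
    unfolding c_def using generic_eval_nonzero assms(2) C by blast
  have c: "c i = (of_real (r i) - a l) * (of_real (r i) - b l)" if "l \<in> ?L" for i l
  proof -
    have e: "c1 = - a l - b l" "c0 = a l * b l"
      using fac[OF that] unfolding C factorization_iff by auto
    show ?thesis
      unfolding c_def e by (simp add: algebra_simps power2_eq_square of_real_def)
  qed
  have QA: "\<exists>Q. complete_quadrilateral Q \<and> (\<forall>L\<in>Q. null_line L) \<and>
    bij_betw (\<lambda>l. pt (a l - qcnj (a l))) ?L (vertices Q) \<and>
    (\<forall>l\<in>?L. \<forall>m\<in>?L. opposite Q (pt (a l - qcnj (a l))) (pt (a m - qcnj (a m)))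
       \<longleftrightarrow> T l \<inter> T m = {})"
    using r T A c c0 by (rule factor_quadrilateral)
  \<comment> \<open>The conjugate of \<open>C\<close> factors as
    \<open>(t - qcnj (b l)) (t - qcnj (a l))\<close>. Its left factors have the norm polynomials of
    the \<open>b l\<close>, whose root sets are the complements of the \<open>T l\<close>.\<close>
  have QB: "\<exists>Q. complete_quadrilateral Q \<and> (\<forall>L\<in>Q. null_line L) \<and>
    bij_betw (\<lambda>l. pt (qcnj (b l) - qcnj (qcnj (b l)))) ?L (vertices Q) \<and>
    (\<forall>l\<in>?L. \<forall>m\<in>?L. opposite Q (pt (qcnj (b l) - qcnj (qcnj (b l)))) (pt (qcnj (b m) - qcnj (qcnj (b m))))
       \<longleftrightarrow> ({..<4} - T l) \<inter> ({..<4} - T m) = {})"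
  proof (rule factor_quadrilateral[where b = "\<lambda>l. qcnj (a l)" and c = "\<lambda>i. qcnj (c i)"])
    show "bij_betw (\<lambda>l. {..<4} - T l) ?L {S. S \<subseteq> {..<4} \<and> card S = 2}"
      by (rule bij_betw_complement_pairs) (use T in auto)
    show "qcnj (c i) \<noteq> 0" for i
      using c0 qcnj_simps(5,7) by metis
  qed (use r B c in auto)
  have co: "({..<4} - T l) \<inter> ({..<4} - T m) = {} \<longleftrightarrow> T l \<inter> T m = {}"
    if "l \<in> ?L" "m \<in> ?L" for l m
  proof -
    have card: "card ({..<4} - T k) = 2" if "k \<in> ?L" for k
      using TL[OF that] by (simp add: card_Diff_subset finite_subset)
    have "({..<4} - T l) \<inter> ({..<4} - T m) = {} \<longleftrightarrow> {..<4} - T m = {..<4} - ({..<4} - T l)"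
      by (rule disjoint_complement_pairs) (use card that in auto)
    also have "\<dots> \<longleftrightarrow> T m = {..<4} - T l"
      using TL(1)[OF that(1)] TL(1)[OF that(2)] by blast
    also have "\<dots> \<longleftrightarrow> T l \<inter> T m = {}"
      by (rule disjoint_complement_pairs[symmetric]) (use TL that in auto)
    finally show ?thesis .
  qed
  show ?thesis
  proof (intro conjI)
    show "\<exists>Q. complete_quadrilateral Q \<and> (\<forall>L\<in>Q. null_line L) \<and>
        bij_betw (\<lambda>l. pt (a l - qcnj (a l))) ?L (vertices Q) \<and>
        (\<forall>l\<in>?L. \<forall>m\<in>?L. l \<noteq> m \<longrightarrow>
           (opposite Q (pt (a l - qcnj (a l))) (pt (a m - qcnj (a m)))
            \<longleftrightarrow> complementary C (a l, b l) (a m, b m)))"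
    proof -
      from QA obtain Q where Q: "complete_quadrilateral Q" "\<forall>L\<in>Q. null_line L"
        "bij_betw (\<lambda>l. pt (a l - qcnj (a l))) ?L (vertices Q)"
        "\<forall>l\<in>?L. \<forall>m\<in>?L. opposite Q (pt (a l - qcnj (a l))) (pt (a m - qcnj (a m)))
          \<longleftrightarrow> T l \<inter> T m = {}"
        by (elim exE conjE)
      show ?thesis
        by (rule exI[of _ Q], intro conjI ballI impI Q(1,2,3)) (simp only: Q(4) compl)
    qed
    show "\<exists>Q. complete_quadrilateral Q \<and> (\<forall>L\<in>Q. null_line L) \<and>
        bij_betw (\<lambda>l. pt (b l - qcnj (b l))) ?L (vertices Q) \<and>
        (\<forall>l\<in>?L. \<forall>m\<in>?L. l \<noteq> m \<longrightarrow>
           (opposite Q (pt (b l - qcnj (b l))) (pt (b m - qcnj (b m)))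
            \<longleftrightarrow> complementary C (a l, b l) (a m, b m)))"
    proof -
      \<comment> \<open>The vectors of \<open>qcnj (b l)\<close> and \<open>b l\<close> differ only
        by sign and give the same point.\<close>
      from QB obtain Q where Q: "complete_quadrilateral Q" "\<forall>L\<in>Q. null_line L"
        "bij_betw (\<lambda>l. pt (b l - qcnj (b l))) ?L (vertices Q)"
        "\<forall>l\<in>?L. \<forall>m\<in>?L. opposite Q (pt (b l - qcnj (b l))) (pt (b m - qcnj (b m)))
          \<longleftrightarrow> ({..<4} - T l) \<inter> ({..<4} - T m) = {}"
        unfolding qcnj_simps(5) pt_conj by (elim exE conjE)
      show ?thesis
        by (rule exI[of _ Q], intro conjI ballI impI Q(1,2,3)) (simp only: Q(4) co compl)
    qed
  qed
qed

end
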